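(* Let $X$ be a complex Banach space with open unit ball $B_X$, and let $\varphi: B_X\to B_X$ be holomorphic. If the composition operator $C_\varphi: H(B_X)\to H(B_X)$, $C_\varphi(f)=f\circ\varphi$, is power bounded, then it is also uniformly mean ergodic.
   Context: A function is holomorphic if it is (complex) Fréchet differentiable at every point. $H(B_X)$ is the space of all holomorphic functions $f:B_X\to\mathbb{C}$ with the topology $\tau_0$ of uniform convergence on compact subsets of $B_X$; it is a locally convex Hausdorff space. For a locally convex Hausdorff space $E$, $L(E)$ is the space of continuous linear maps $E\to E$. For $T\in L(E)$, $T^n$ is the $n$-th iterate ($T^0=\mathrm{id}$) and $T_{[n]}=\frac1n\sum_{k=0}^{n-1}T^k$. $T$ is power bounded if $\{T^n:n\ge0\}$ is equicontinuous. $T$ is uniformly mean ergodic if $(T_{[n]})_n$ converges in $L(E)$ uniformly on the bounded subsets of $E$ (the topology of bounded convergence of $L(E)$). *)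

theory Defs
  imports "HOL-Analysis.Analysis"
begin

section \<open>Complex vector spaces, normed spaces and Banach spaces\<close>

class complex_vector = real_vector +
  fixes scaleC :: "complex \<Rightarrow> 'a \<Rightarrow> 'a"  (infixr \<open>*\<^sub>C\<close> 75)
  assumes scaleC_add_right: "c *\<^sub>C (x + y) = c *\<^sub>C x + c *\<^sub>C y"
    and scaleC_add_left: "(c + d) *\<^sub>C x = c *\<^sub>C x + d *\<^sub>C x"
    and scaleC_scaleC: "c *\<^sub>C d *\<^sub>C x = (c * d) *\<^sub>C x"
    and scaleC_one: "1 *\<^sub>C x = x"
    and scaleR_scaleC: "r *\<^sub>R x = complex_of_real r *\<^sub>C x"

class complex_normed_vector = complex_vector + real_normed_vector +
  assumes norm_scaleC: "norm (c *\<^sub>C x) = norm c * norm x"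

class complex_banach = complex_normed_vector + banach

instantiation complex :: complex_banach
begin

definition scaleC_complex :: "complex \<Rightarrow> complex \<Rightarrow> complex"
  where "scaleC_complex c x = c * x"

instance
  by standard (auto simp: scaleC_complex_def algebra_simps norm_mult scaleR_conv_of_real)

end

definition clinear_map :: "('a::complex_vector \<Rightarrow> 'b::complex_vector) \<Rightarrow> bool"
  where "clinear_map T \<longleftrightarrow>
    (\<forall>x y. T (x + y) = T x + T y) \<and> (\<forall>c x. T (c *\<^sub>C x) = c *\<^sub>C T x)"


section \<open>Holomorphic maps between complex normed spaces\<close>

text \<open>The predicate \<^const>\<open>has_derivative\<close> only provides a bounded real-linear derivative;
  complex linearity is required in addition.\<close>

definition frechet_holomorphic_on ::
    "('a::complex_normed_vector \<Rightarrow> 'b::complex_normed_vector) \<Rightarrow> 'a set \<Rightarrow> bool"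
    (infixl \<open>frechet'_holomorphic'_on\<close> 50)
  where "f frechet_holomorphic_on S \<longleftrightarrow>
    (\<forall>x\<in>S. \<exists>D. clinear_map D \<and> (f has_derivative D) (at x within S))"

lemma frechet_holomorphic_on_imp_continuous_on:
  "f frechet_holomorphic_on S \<Longrightarrow> continuous_on S f"
  unfolding frechet_holomorphic_on_def continuous_on_eq_continuous_within
  by (blast intro: has_derivative_continuous)

lemma frechet_holomorphic_on_zero: "(\<lambda>x. 0) frechet_holomorphic_on S"
proof -
  have "clinear_map (\<lambda>h::'a. 0::'b)"
    unfolding clinear_map_def
    by (metis add_0 add_cancel_right_right scaleC_add_right)
  then show ?thesis
    unfolding frechet_holomorphic_on_def by (blast intro: has_derivative_const)
qed

lemma frechet_holomorphic_on_add:
  assumes "f frechet_holomorphic_on S" "g frechet_holomorphic_on S"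
  shows "(\<lambda>x. f x + g x) frechet_holomorphic_on S"
  unfolding frechet_holomorphic_on_def
proof
  fix x assume "x \<in> S"
  then obtain D E where "clinear_map D" "(f has_derivative D) (at x within S)"
    "clinear_map E" "(g has_derivative E) (at x within S)"
    using assms unfolding frechet_holomorphic_on_def by blast
  moreover from this have "clinear_map (\<lambda>h. D h + E h)"
    by (simp add: clinear_map_def scaleC_add_right)
  ultimately show "\<exists>D. clinear_map D \<and> ((\<lambda>x. f x + g x) has_derivative D) (at x within S)"
    by (blast intro: has_derivative_add)
qed

lemma frechet_holomorphic_on_cmult:
  fixes f :: "'a::complex_normed_vector \<Rightarrow> complex"
  assumes "f frechet_holomorphic_on S"
  shows "(\<lambda>x. c * f x) frechet_holomorphic_on S"
  unfolding frechet_holomorphic_on_def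
proof
  fix x assume "x \<in> S"
  then obtain D where "clinear_map D" "(f has_derivative D) (at x within S)"
    using assms unfolding frechet_holomorphic_on_def by blast
  moreover from this have "clinear_map (\<lambda>h. c * D h)"
    by (simp add: clinear_map_def scaleC_complex_def algebra_simps)
  ultimately show "\<exists>D. clinear_map D \<and> ((\<lambda>x. c * f x) has_derivative D) (at x within S)"
    by (blast intro: has_derivative_mult_right)
qed

lemma frechet_holomorphic_on_compose:
  assumes "f frechet_holomorphic_on S" "g frechet_holomorphic_on T" "f ` S \<subseteq> T"
  shows "(\<lambda>x. g (f x)) frechet_holomorphic_on S"
  unfolding frechet_holomorphic_on_def
proof
  fix x assume "x \<in> S"
  then obtain D E where D: "clinear_map D" "(f has_derivative D) (at x within S)"
    and E: "clinear_map E" "(g has_derivative E) (at (f x) within T)"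
    using assms unfolding frechet_holomorphic_on_def by blast
  have "((\<lambda>x. g (f x)) has_derivative (\<lambda>h. E (D h))) (at x within S)"
    using D(2) has_derivative_subset[OF E(2) assms(3)] by (rule has_derivative_in_compose)
  moreover have "clinear_map (\<lambda>h. E (D h))"
    using D(1) E(1) by (simp add: clinear_map_def)
  ultimately show "\<exists>D. clinear_map D \<and> ((\<lambda>x. g (f x)) has_derivative D) (at x within S)"
    by blast
qed

lemma frechet_holomorphic_on_cong:
  assumes "f frechet_holomorphic_on S" "\<And>x. x \<in> S \<Longrightarrow> f x = g x"
  shows "g frechet_holomorphic_on S"
  using assms unfolding frechet_holomorphic_on_def
  by (metis has_derivative_transform)


section \<open>Operators on complex locally convex Hausdorff spaces\<close>

class complex_lcs = complex_vector + topological_ab_group_add + t2_space +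
  assumes tendsto_scaleC_Pair: "LIM p (nhds c \<times>\<^sub>F nhds x). fst p *\<^sub>C snd p :> nhds (c *\<^sub>C x)"
    and locally_convex_raw: "\<lbrakk>open U; 0 \<in> U\<rbrakk> \<Longrightarrow> \<exists>V. open V \<and> 0 \<in> V \<and> V \<subseteq> U \<and>
      (\<forall>x\<in>V. \<forall>y\<in>V. \<forall>u\<ge>0. \<forall>v\<ge>0. u + v = 1 \<longrightarrow> u *\<^sub>R x + v *\<^sub>R y \<in> V)"

text \<open>The constant \<^const>\<open>convex\<close> cannot occur in the class specification itself.\<close>

lemma locally_convex:
  fixes U :: "'e::complex_lcs set"
  assumes "open U" "0 \<in> U"
  shows "\<exists>V. open V \<and> 0 \<in> V \<and> convex V \<and> V \<subseteq> U"
  using locally_convex_raw[OF assms] unfolding convex_def by blast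

definition continuous_operators :: "('e::complex_lcs \<Rightarrow> 'e) set"
  where "continuous_operators = {T. clinear_map T \<and> continuous_on UNIV T}"

definition cesaro_mean :: "('e::complex_lcs \<Rightarrow> 'e) \<Rightarrow> nat \<Rightarrow> 'e \<Rightarrow> 'e"
  where "cesaro_mean T n x = (1 / real n) *\<^sub>R (\<Sum>k<n. (T ^^ k) x)"

text \<open>Equicontinuity for families of linear maps, and boundedness in the sense of
  topological vector spaces.\<close>

definition equicontinuous :: "('e::complex_lcs \<Rightarrow> 'e) set \<Rightarrow> bool"
  where "equicontinuous \<T> \<longleftrightarrow>
    (\<forall>U. open U \<and> 0 \<in> U \<longrightarrow> (\<exists>V. open V \<and> 0 \<in> V \<and> (\<forall>T\<in>\<T>. T ` V \<subseteq> U)))"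

definition lcs_bounded :: "'e::complex_lcs set \<Rightarrow> bool"
  where "lcs_bounded B \<longleftrightarrow>
    (\<forall>U. open U \<and> 0 \<in> U \<longrightarrow> (\<exists>s>0. \<forall>t>s. B \<subseteq> (\<lambda>x. t *\<^sub>R x) ` U))"

definition power_bounded :: "('e::complex_lcs \<Rightarrow> 'e) \<Rightarrow> bool"
  where "power_bounded T \<longleftrightarrow> equicontinuous {T ^^ n | n. True}"

definition converges_uniformly_on_bounded ::
    "(nat \<Rightarrow> 'e::complex_lcs \<Rightarrow> 'e) \<Rightarrow> ('e \<Rightarrow> 'e) \<Rightarrow> bool"
  where "converges_uniformly_on_bounded S P \<longleftrightarrow>
    (\<forall>B U. lcs_bounded B \<and> open U \<and> 0 \<in> U \<longrightarrow>
      (\<forall>\<^sub>F n in sequentially. \<forall>x\<in>B. S n x - P x \<in> U))"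

definition uniformly_mean_ergodic :: "('e::complex_lcs \<Rightarrow> 'e) \<Rightarrow> bool"
  where "uniformly_mean_ergodic T \<longleftrightarrow>
    (\<exists>P\<in>continuous_operators. converges_uniformly_on_bounded (cesaro_mean T) P)"


section \<open>The space of holomorphic functions on the open unit ball\<close>

text \<open>Functions on the ball are represented by total functions that vanish outside it.\<close>

typedef (overloaded) 'a holo_ball =
  "{f :: 'a::complex_normed_vector \<Rightarrow> complex.
      f frechet_holomorphic_on ball 0 1 \<and> (\<forall>x. x \<notin> ball 0 1 \<longrightarrow> f x = 0)}"
  morphisms holo_apply Abs_holo_ball
  by (rule exI[of _ "\<lambda>x. 0"]) (simp add: frechet_holomorphic_on_zero)

setup_lifting type_definition_holo_ball

lemma holo_apply_holomorphic: "holo_apply f frechet_holomorphic_on ball 0 1"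
  and holo_apply_outside: "x \<notin> ball 0 1 \<Longrightarrow> holo_apply f x = 0"
  using holo_apply[of f] by auto

lemma holo_ball_eqI: "(\<And>x. x \<in> ball 0 1 \<Longrightarrow> holo_apply f x = holo_apply g x) \<Longrightarrow> f = g"
  by (metis holo_apply_inject holo_apply_outside ext)

instantiation holo_ball :: (complex_normed_vector) complex_vector
begin

lift_definition zero_holo_ball :: "'a holo_ball" is "\<lambda>x. 0"
  by (simp add: frechet_holomorphic_on_zero)

lift_definition plus_holo_ball :: "'a holo_ball \<Rightarrow> 'a holo_ball \<Rightarrow> 'a holo_ball"
  is "\<lambda>f g x. f x + g x"
  by (simp add: frechet_holomorphic_on_add)

lift_definition scaleC_holo_ball :: "complex \<Rightarrow> 'a holo_ball \<Rightarrow> 'a holo_ball"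
  is "\<lambda>c f x. c * f x"
  by (simp add: frechet_holomorphic_on_cmult)

lift_definition scaleR_holo_ball :: "real \<Rightarrow> 'a holo_ball \<Rightarrow> 'a holo_ball"
  is "\<lambda>r f x. complex_of_real r * f x"
  by (simp add: frechet_holomorphic_on_cmult)

lift_definition uminus_holo_ball :: "'a holo_ball \<Rightarrow> 'a holo_ball"
  is "\<lambda>f x. - f x"
  using frechet_holomorphic_on_cmult[where c = "-1"] by auto

definition minus_holo_ball :: "'a holo_ball \<Rightarrow> 'a holo_ball \<Rightarrow> 'a holo_ball"
  where "minus_holo_ball f g = f + - g"

instance
  by standard (unfold minus_holo_ball_def, (transfer, auto simp: algebra_simps)+)

end

lemma holo_apply_simps [simp]:
  "holo_apply 0 x = 0"
  "holo_apply (f + g) x = holo_apply f x + holo_apply g x"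
  "holo_apply (- f) x = - holo_apply f x"
  "holo_apply (f - g) x = holo_apply f x - holo_apply g x"
  "holo_apply (c *\<^sub>C f) x = c * holo_apply f x"
  "holo_apply (r *\<^sub>R f) x = complex_of_real r * holo_apply f x"
  unfolding minus_holo_ball_def by (transfer, simp)+

definition compact_nbhd ::
    "'a::complex_normed_vector holo_ball \<Rightarrow> 'a set \<Rightarrow> real \<Rightarrow> 'a holo_ball set"
  where "compact_nbhd f K e = {g. \<forall>x\<in>K. cmod (holo_apply g x - holo_apply f x) < e}"

text \<open>The topology of uniform convergence on compact subsets of the ball.\<close>

instantiation holo_ball :: (complex_normed_vector) topological_space
begin

definition open_holo_ball :: "'a holo_ball set \<Rightarrow> bool"
  where "open_holo_ball U \<longleftrightarrow>
    (\<forall>f\<in>U. \<exists>K e. compact K \<and> K \<subseteq> ball 0 1 \<and> e > 0 \<and> compact_nbhd f K e \<subseteq> U)"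

instance
proof
  show "open (UNIV :: 'a holo_ball set)"
    unfolding open_holo_ball_def
    by (intro ballI exI[of _ "{}"] exI[of _ 1]) auto
next
  fix S T :: "'a holo_ball set"
  assume S: "open S" and T: "open T"
  show "open (S \<inter> T)"
    unfolding open_holo_ball_def
  proof
    fix f assume f: "f \<in> S \<inter> T"
    obtain K d where K: "compact K" "K \<subseteq> ball 0 1" "d > 0" "compact_nbhd f K d \<subseteq> S"
      using S f unfolding open_holo_ball_def by blast
    obtain L e where L: "compact L" "L \<subseteq> ball 0 1" "e > 0" "compact_nbhd f L e \<subseteq> T"
      using T f unfolding open_holo_ball_def by blast
    have "compact_nbhd f (K \<union> L) (min d e) \<subseteq> compact_nbhd f K d \<inter> compact_nbhd f L e"
      unfolding compact_nbhd_def by auto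
    then show "\<exists>K e. compact K \<and> K \<subseteq> ball 0 1 \<and> e > 0 \<and> compact_nbhd f K e \<subseteq> S \<inter> T"
      using K L by (intro exI[of _ "K \<union> L"] exI[of _ "min d e"]) (auto intro: compact_Un)
  qed
next
  fix \<K> :: "'a holo_ball set set"
  assume "\<forall>S\<in>\<K>. open S"
  then show "open (\<Union>\<K>)"
    unfolding open_holo_ball_def by (meson Union_iff Sup_upper subset_trans)
qed

end

lemma mem_compact_nbhd: "e > 0 \<Longrightarrow> f \<in> compact_nbhd f K e"
  by (simp add: compact_nbhd_def)

lemma holo_apply_continuous_on: "K \<subseteq> ball 0 1 \<Longrightarrow> continuous_on K (holo_apply f)"
  using frechet_holomorphic_on_imp_continuous_on[OF holo_apply_holomorphic]
  by (rule continuous_on_subset)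

lemma open_compact_nbhd:
  assumes K: "compact K" "K \<subseteq> ball 0 1"
  shows "open (compact_nbhd f K e)"
  unfolding open_holo_ball_def
proof
  fix g assume g: "g \<in> compact_nbhd f K e"
  show "\<exists>L d. compact L \<and> L \<subseteq> ball 0 1 \<and> d > 0 \<and> compact_nbhd g L d \<subseteq> compact_nbhd f K e"
  proof (cases "K = {}")
    case True
    then show ?thesis
      by (intro exI[of _ "{}"] exI[of _ 1]) (auto simp: compact_nbhd_def)
  next
    case False
    have "continuous_on K (\<lambda>x. cmod (holo_apply g x - holo_apply f x))"
      by (intro continuous_intros holo_apply_continuous_on K)
    then obtain z where z: "z \<in> K"
      "\<And>x. x \<in> K \<Longrightarrow>
        cmod (holo_apply g x - holo_apply f x) \<le> cmod (holo_apply g z - holo_apply f z)"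
      using continuous_attains_sup[OF K(1) False] by blast
    define d where "d = e - cmod (holo_apply g z - holo_apply f z)"
    have d: "d > 0"
      using g z(1) by (simp add: d_def compact_nbhd_def)
    have "compact_nbhd g K d \<subseteq> compact_nbhd f K e"
    proof
      fix h assume h: "h \<in> compact_nbhd g K d"
      have "cmod (holo_apply h x - holo_apply f x) < e" if "x \<in> K" for x
      proof -
        have "cmod (holo_apply h x - holo_apply f x)
            \<le> cmod (holo_apply h x - holo_apply g x) + cmod (holo_apply g x - holo_apply f x)"
          by (rule order_trans[OF eq_refl norm_triangle_ineq]) simp
        moreover have "cmod (holo_apply h x - holo_apply g x) < d"
          using h that by (simp add: compact_nbhd_def)
        ultimately show ?thesis
          using z(2)[OF that] by (simp add: d_def)
      qed
      then show "h \<in> compact_nbhd f K e"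
        by (simp add: compact_nbhd_def)
    qed
    then show ?thesis
      using K d by blast
  qed
qed

lemma tendsto_holo_ball_iff:
  fixes f :: "'a::complex_normed_vector holo_ball"
  shows "(F \<longlongrightarrow> f) G \<longleftrightarrow>
    (\<forall>K. compact K \<and> K \<subseteq> ball 0 1 \<longrightarrow> uniform_limit K (\<lambda>i. holo_apply (F i)) (holo_apply f) G)"
proof (intro iffI allI impI)
  fix K :: "'a set"
  assume "(F \<longlongrightarrow> f) G" and K: "compact K \<and> K \<subseteq> ball 0 1"
  show "uniform_limit K (\<lambda>i. holo_apply (F i)) (holo_apply f) G"
    unfolding uniform_limit_iff
  proof (intro allI impI)
    fix e :: real assume "e > 0"
    then have "\<forall>\<^sub>F i in G. F i \<in> compact_nbhd f K e"
      using \<open>(F \<longlongrightarrow> f) G\<close> K mem_compact_nbhd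
      by (intro topological_tendstoD open_compact_nbhd) blast+
    then show "\<forall>\<^sub>F i in G. \<forall>x\<in>K. dist (holo_apply (F i) x) (holo_apply f x) < e"
      by (simp add: compact_nbhd_def dist_norm)
  qed
next
  assume *: "\<forall>K. compact K \<and> K \<subseteq> ball 0 1 \<longrightarrow>
    uniform_limit K (\<lambda>i. holo_apply (F i)) (holo_apply f) G"
  show "(F \<longlongrightarrow> f) G"
  proof (rule topological_tendstoI)
    fix U :: "'a holo_ball set" assume "open U" "f \<in> U"
    then obtain K e where K: "compact K" "K \<subseteq> ball 0 1" "e > 0" "compact_nbhd f K e \<subseteq> U"
      unfolding open_holo_ball_def by blast
    then have "\<forall>\<^sub>F i in G. \<forall>x\<in>K. dist (holo_apply (F i) x) (holo_apply f x) < e"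
      using * by (simp add: uniform_limit_iff)
    then show "\<forall>\<^sub>F i in G. F i \<in> U"
      by eventually_elim (use K(4) in \<open>auto simp: compact_nbhd_def dist_norm\<close>)
  qed
qed

instance holo_ball :: (complex_normed_vector) complex_lcs
proof
  fix a b :: "'a holo_ball"
  have "((\<lambda>p. fst p + snd p) \<longlongrightarrow> a + b) (nhds a \<times>\<^sub>F nhds b)"
    unfolding tendsto_holo_ball_iff holo_apply_simps
    using filterlim_fst[of "nhds a" "nhds b"] filterlim_snd[of "nhds b" "nhds a"]
    by (auto intro!: uniform_limit_add simp: tendsto_holo_ball_iff)
  then show "LIM p (nhds a \<times>\<^sub>F nhds b). fst p + snd p :> nhds (a + b)" .
next
  fix a :: "'a holo_ball"
  show "(uminus \<longlongrightarrow> - a) (nhds a)"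
    unfolding tendsto_holo_ball_iff holo_apply_simps
    using filterlim_ident[of "nhds a"]
    by (auto intro!: uniform_limit_uminus simp: tendsto_holo_ball_iff)
next
  fix f g :: "'a holo_ball" assume "f \<noteq> g"
  then obtain z where z: "z \<in> ball 0 1" "holo_apply f z \<noteq> holo_apply g z"
    using holo_ball_eqI by blast
  define e where "e = cmod (holo_apply f z - holo_apply g z) / 2"
  have e: "e > 0"
    using z(2) by (simp add: e_def)
  have "compact_nbhd f {z} e \<inter> compact_nbhd g {z} e = {}"
  proof (rule ccontr)
    assume "compact_nbhd f {z} e \<inter> compact_nbhd g {z} e \<noteq> {}"
    then obtain h where "dist (holo_apply h z) (holo_apply f z) < e"
      "dist (holo_apply h z) (holo_apply g z) < e"
      by (auto simp: compact_nbhd_def dist_norm)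
    then have "dist (holo_apply f z) (holo_apply g z) < 2 * e"
      by (metis dist_triangle_half_r[of "holo_apply h z" _ "2 * e"] dist_commute
          nonzero_mult_div_cancel_left zero_neq_numeral)
    then show False
      by (simp add: e_def dist_norm)
  qed
  then show "\<exists>U V. open U \<and> open V \<and> f \<in> U \<and> g \<in> V \<and> U \<inter> V = {}"
    using e z(1) by (intro exI[of _ "compact_nbhd f {z} e"] exI[of _ "compact_nbhd g {z} e"])
      (auto intro!: open_compact_nbhd mem_compact_nbhd)
next
  fix c :: complex and f :: "'a holo_ball"
  have "((\<lambda>p. fst p *\<^sub>C snd p) \<longlongrightarrow> c *\<^sub>C f) (nhds c \<times>\<^sub>F nhds f)"
    unfolding tendsto_holo_ball_iff holo_apply_simps
  proof (intro allI impI)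
    fix K :: "'a set" assume K: "compact K \<and> K \<subseteq> ball 0 1"
    have "uniform_limit K (\<lambda>p x. fst p) (\<lambda>x. c) (nhds c \<times>\<^sub>F nhds f)"
      using filterlim_fst[of "nhds c" "nhds f"]
      by (auto simp: uniform_limit_iff tendsto_iff elim!: eventually_mono)
    moreover have "uniform_limit K (\<lambda>p. holo_apply (snd p)) (holo_apply f) (nhds c \<times>\<^sub>F nhds f)"
      using filterlim_snd[of "nhds f" "nhds c"] K by (simp add: tendsto_holo_ball_iff)
    moreover have "bounded ((\<lambda>x. c) ` K)"
      by (rule bounded_subset[of "{c}"]) auto
    moreover have "bounded (holo_apply f ` K)"
      using K by (intro compact_imp_bounded compact_continuous_image holo_apply_continuous_on) auto
    ultimately show "uniform_limit K (\<lambda>p x. fst p * holo_apply (snd p) x)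
        (\<lambda>x. c * holo_apply f x) (nhds c \<times>\<^sub>F nhds f)"
      by (rule uniform_lim_mult)
  qed
  then show "LIM p (nhds c \<times>\<^sub>F nhds f). fst p *\<^sub>C snd p :> nhds (c *\<^sub>C f)" .
next
  fix U :: "'a holo_ball set" assume "open U" "0 \<in> U"
  then obtain K e where K: "compact K" "K \<subseteq> ball 0 1" "e > 0" "compact_nbhd 0 K e \<subseteq> U"
    unfolding open_holo_ball_def by blast
  have "convex (compact_nbhd 0 K e :: 'a holo_ball set)"
  proof (rule convexI)
    fix f g :: "'a holo_ball" and u v :: real
    assume fg: "f \<in> compact_nbhd 0 K e" "g \<in> compact_nbhd 0 K e"
      and uv: "0 \<le> u" "0 \<le> v" "u + v = 1"
    show "u *\<^sub>R f + v *\<^sub>R g \<in> compact_nbhd 0 K e"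
      unfolding compact_nbhd_def
    proof (clarsimp)
      fix x assume "x \<in> K"
      then have "u *\<^sub>R holo_apply f x + v *\<^sub>R holo_apply g x \<in> ball 0 e"
        using fg uv by (intro convexD[OF convex_ball]) (auto simp: compact_nbhd_def)
      then show "cmod (complex_of_real u * holo_apply f x + complex_of_real v * holo_apply g x) < e"
        by (simp add: scaleR_conv_of_real)
    qed
  qed
  then show "\<exists>V. open V \<and> 0 \<in> V \<and> V \<subseteq> U \<and>
      (\<forall>x\<in>V. \<forall>y\<in>V. \<forall>u\<ge>0. \<forall>v\<ge>0. u + v = 1 \<longrightarrow> u *\<^sub>R x + v *\<^sub>R y \<in> V)"
    using K open_compact_nbhd[OF K(1,2)] mem_compact_nbhd[OF K(3)] unfolding convex_def
    by (intro exI[of _ "compact_nbhd 0 K e"]) auto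
qed

text \<open>The value outside the ball is forced by the representation; the definition is meaningful
  when \<open>\<phi>\<close> is a holomorphic self-map of the ball.\<close>

definition composition_operator ::
    "('a::complex_normed_vector \<Rightarrow> 'a) \<Rightarrow> 'a holo_ball \<Rightarrow> 'a holo_ball"
  where "composition_operator \<phi> f =
    Abs_holo_ball (\<lambda>x. if x \<in> ball 0 1 then holo_apply f (\<phi> x) else 0)"

lemma holo_apply_composition_operator:
  assumes "\<phi> frechet_holomorphic_on ball 0 1" "\<phi> ` ball 0 1 \<subseteq> ball 0 1"
  shows "holo_apply (composition_operator \<phi> f) x =
    (if x \<in> ball 0 1 then holo_apply f (\<phi> x) else 0)"
proof -
  have "(\<lambda>x. holo_apply f (\<phi> x)) frechet_holomorphic_on ball 0 1"
    by (rule frechet_holomorphic_on_compose[OF assms(1) holo_apply_holomorphic assms(2)])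
  then have "(\<lambda>x. if x \<in> ball 0 1 then holo_apply f (\<phi> x) else 0) frechet_holomorphic_on ball 0 1"
    by (rule frechet_holomorphic_on_cong) simp
  then show ?thesis
    unfolding composition_operator_def by (subst Abs_holo_ball_inverse) auto
qed

lemma composition_operator_continuous:
  assumes "\<phi> frechet_holomorphic_on ball 0 1" "\<phi> ` ball 0 1 \<subseteq> ball 0 1"
  shows "composition_operator \<phi> \<in> continuous_operators"
proof -
  have "clinear_map (composition_operator \<phi>)"
    unfolding clinear_map_def
    by (auto intro!: holo_ball_eqI simp: holo_apply_composition_operator[OF assms])
  moreover have "(composition_operator \<phi> \<longlongrightarrow> composition_operator \<phi> f) (nhds f)" for f
    unfolding tendsto_holo_ball_iff
  proof (intro allI impI)
    fix K :: "'a set" assume K: "compact K \<and> K \<subseteq> ball 0 1"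
    have "continuous_on K \<phi>"
      using frechet_holomorphic_on_imp_continuous_on[OF assms(1)] K
      by (blast intro: continuous_on_subset)
    then have "compact (\<phi> ` K) \<and> \<phi> ` K \<subseteq> ball 0 1"
      using K assms(2) by (blast intro: compact_continuous_image)
    then have "uniform_limit (\<phi> ` K) holo_apply (holo_apply f) (nhds f)"
      using filterlim_ident[of "nhds f"] by (simp add: tendsto_holo_ball_iff)
    then show "uniform_limit K (\<lambda>g. holo_apply (composition_operator \<phi> g))
        (holo_apply (composition_operator \<phi> f)) (nhds f)"
      unfolding uniform_limit_iff holo_apply_composition_operator[OF assms]
      by (auto elim!: eventually_mono)
  qed
  then have "continuous_on UNIV (composition_operator \<phi>)"
    unfolding continuous_on_def at_within_def
    by (blast intro: filterlim_mono order_refl inf_le1)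
  ultimately show ?thesis
    by (simp add: continuous_operators_def)
qed

end

theory Submission
  imports Defs "HOL-Complex_Analysis.Cauchy_Integral_Formula"
begin

text \<open>
  Two facts combine.

  The first is Montel's theorem for the ball of a normed space, \<open>holo_ball_Montel\<close>: every bounded set of the
  space of holomorphic functions is relatively compact. A family that is bounded on compact sets is locally
  bounded, because a convergent sequence together with its limit is compact. Cauchy's estimates on complex
  lines then bound the derivatives and the first order Taylor remainders at each point uniformly over the
  family. Tychonoff's theorem provides pointwise cluster points, both for the functions and for their
  derivatives; the uniform Taylor bound survives the limit, which is therefore holomorphic, and
  equicontinuity turns pointwise convergence into uniform convergence on compact sets. As the ball need not
  be separable, all this is done with filters in place of subsequences.

  The second is Yosida's mean ergodic theorem, \<open>uniformly_mean_ergodic_if_bounded_sets_cluster\<close>: in a locally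
  convex space in which bounded sets are relatively compact, a power bounded operator \<open>T\<close> is uniformly mean
  ergodic. The averages of \<open>x\<close> are bounded, so that they have a cluster point \<open>y\<close>. It is fixed by \<open>T\<close>,
  because the averages tend to \<open>0\<close> on the range of \<open>id - T\<close>. Since moreover \<open>x - y\<close> lies in the closure of
  this range and the averages are equicontinuous, the whole sequence converges to \<open>y\<close>. Finally, pointwise
  convergence of an equicontinuous sequence is uniform on relatively compact sets, hence on bounded sets.
\<close>

section \<open>Cluster points of filters\<close>

text \<open>Passing to a finer filter plays the role of passing to a subnet: the finer filter is obtained by
  adding the preimages of the neighbourhoods of the cluster point.\<close>

lemma subnet_of_cluster_point:
  assumes "inf (nhds g) (filtermap u F) \<noteq> bot"
  shows "\<exists>H. H \<le> F \<and> H \<noteq> bot \<and> (u \<longlongrightarrow> g) H"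
proof (intro exI conjI)
  let ?H = "inf F (filtercomap u (nhds g))"
  show "?H \<le> F" by simp
  show "(u \<longlongrightarrow> g) ?H"
    by (meson filterlim_filtercomap filterlim_mono inf_le2 order_refl)
  show "?H \<noteq> bot"
  proof
    assume "?H = bot"
    then have "eventually (\<lambda>_. False) ?H" by simp
    then obtain Q R where "eventually Q F" "eventually R (filtercomap u (nhds g))"
      and QR: "\<And>x. Q x \<Longrightarrow> R x \<Longrightarrow> False"
      unfolding eventually_inf by blast
    then obtain R' where R': "eventually R' (nhds g)" "\<And>x. R' (u x) \<Longrightarrow> R x"
      unfolding eventually_filtercomap by blast
    have "eventually (\<lambda>y. \<not> R' y) (filtermap u F)"
      unfolding eventually_filtermap using \<open>eventually Q F\<close>
      by eventually_elim (use QR R'(2) in blast)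
    then have "eventually (\<lambda>_. False) (inf (nhds g) (filtermap u F))"
      unfolding eventually_inf using R'(1) by blast
    then show False using assms by (simp add: eventually_False)
  qed
qed

section \<open>Locally convex spaces\<close>

lemma tendsto_scaleR_lcs:
  fixes x :: "'e::complex_lcs"
  assumes "(r \<longlongrightarrow> c) F" "(u \<longlongrightarrow> x) F"
  shows "((\<lambda>i. r i *\<^sub>R u i) \<longlongrightarrow> c *\<^sub>R x) F"
proof -
  have "((\<lambda>i. complex_of_real (r i)) \<longlongrightarrow> complex_of_real c) F"
    using assms(1) by (rule tendsto_of_real)
  then have "LIM i F. (complex_of_real (r i), u i) :> nhds (complex_of_real c) \<times>\<^sub>F nhds x"
    using assms(2) by (rule filterlim_Pair)
  from filterlim_compose[OF tendsto_scaleC_Pair this] show ?thesis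
    by (simp add: scaleR_scaleC)
qed

lemma open_half_neighbourhood:
  fixes U :: "'e::complex_lcs set"
  assumes "open U" "0 \<in> U"
  shows "\<exists>W. open W \<and> 0 \<in> W \<and> (\<forall>x\<in>W. \<forall>y\<in>W. x + y \<in> U)"
proof -
  have "LIM p nhds 0 \<times>\<^sub>F nhds 0. fst p + snd p :> nhds (0::'e)"
    using tendsto_add_Pair[of 0 "0::'e"] by simp
  from topological_tendstoD[OF this assms]
  have "\<forall>\<^sub>F p in nhds 0 \<times>\<^sub>F nhds 0. fst p + snd p \<in> U" .
  then obtain P Q where PQ: "eventually P (nhds 0)" "eventually Q (nhds (0::'e))"
    "\<And>x y. P x \<Longrightarrow> Q y \<Longrightarrow> x + y \<in> U"
    by (auto simp: eventually_prod_filter)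
  then have "eventually (\<lambda>x. P x \<and> Q x) (nhds 0)"
    by (simp add: eventually_conj)
  then obtain S where S: "open S" "0 \<in> S" "\<And>x. x \<in> S \<Longrightarrow> P x \<and> Q x"
    unfolding eventually_nhds by blast
  have "x + y \<in> U" if "x \<in> S" "y \<in> S" for x y
    using PQ(3) S(3) that by blast
  then show ?thesis using S(1,2) by blast
qed

text \<open>This replaces the norm estimate by which the boundary terms \<open>T\<^sup>n x / n\<close> of telescoping sums
  disappear.\<close>

lemma bounded_over_n_tendsto_0:
  fixes b :: "nat \<Rightarrow> 'e::complex_lcs"
  assumes "lcs_bounded (range b)"
  shows "(\<lambda>n. (1 / real n) *\<^sub>R b n) \<longlonglongrightarrow> 0"
proof (rule topological_tendstoI)
  fix U :: "'e set" assume "open U" "0 \<in> U"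
  then obtain s where s: "s > 0" "\<And>t. t > s \<Longrightarrow> range b \<subseteq> (\<lambda>x. t *\<^sub>R x) ` U"
    using assms unfolding lcs_bounded_def by blast
  obtain N where N: "s < real N"
    using reals_Archimedean2 by blast
  show "\<forall>\<^sub>F n in sequentially. (1 / real n) *\<^sub>R b n \<in> U"
    using eventually_ge_at_top[of N]
  proof eventually_elim
    case (elim n)
    then have "s < real n" using N by linarith
    then obtain z where "z \<in> U" "b n = real n *\<^sub>R z"
      using s(2) by blast
    then show ?case using \<open>s < real n\<close> s(1) by simp
  qed
qed

text \<open>A neighbourhood \<open>V\<close> that every \<open>S n\<close> maps into \<open>U\<close> absorbs \<open>x\<close>, and by homogeneity \<open>U\<close> then absorbs
  the orbit of \<open>x\<close>.\<close>

lemma lcs_bounded_orbit_if_equicontinuous: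
  fixes S :: "nat \<Rightarrow> 'e::complex_lcs \<Rightarrow> 'e"
  assumes equi: "\<And>U. open U \<Longrightarrow> 0 \<in> U \<Longrightarrow> \<exists>V. open V \<and> 0 \<in> V \<and> (\<forall>n. S n ` V \<subseteq> U)"
    and S: "\<And>n. linear (S n)"
  shows "lcs_bounded (range (\<lambda>n. S n x))"
  unfolding lcs_bounded_def
proof (intro allI impI)
  fix U :: "'e set" assume "open U \<and> 0 \<in> U"
  then obtain V where V: "open V" "0 \<in> V" "\<And>n. S n ` V \<subseteq> U"
    using equi by blast
  have "((\<lambda>t. (1 / t) *\<^sub>R x) \<longlongrightarrow> 0 *\<^sub>R x) at_top"
    by (intro tendsto_scaleR_lcs tendsto_const tendsto_divide_0[OF tendsto_const]
        filterlim_at_top_imp_at_infinity filterlim_ident)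
  then have "\<forall>\<^sub>F t::real in at_top. (1 / t) *\<^sub>R x \<in> V"
    using V by (auto dest: topological_tendstoD)
  then obtain s where s: "\<And>t::real. t \<ge> s \<Longrightarrow> (1 / t) *\<^sub>R x \<in> V"
    unfolding eventually_at_top_linorder by blast
  have "S n x \<in> (\<lambda>x. t *\<^sub>R x) ` U" if "t > max 1 s" for n t
  proof (rule image_eqI)
    show "S n ((1 / t) *\<^sub>R x) \<in> U"
      using V(3) s[of t] that by auto
    show "S n x = t *\<^sub>R S n ((1 / t) *\<^sub>R x)"
      using that by (simp add: linear_cmul[OF S])
  qed
  then show "\<exists>s>0. \<forall>t>s. range (\<lambda>n. S n x) \<subseteq> (\<lambda>x. t *\<^sub>R x) ` U"
    by (intro exI[of _ "max 1 s"]) auto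
qed

section \<open>The mean ergodic theorem\<close>

context
  fixes T :: "'e::complex_lcs \<Rightarrow> 'e"
  assumes T_op: "T \<in> continuous_operators" and T_pb: "power_bounded T"
begin

lemma operator_linear: "linear T"
  using T_op unfolding continuous_operators_def clinear_map_def
  by (intro linearI) (auto simp: scaleR_scaleC)

lemma power_linear: "linear (T ^^ n)"
proof (induction n)
  case (Suc n)
  then show ?case
    using linear_compose[OF Suc operator_linear] by (simp add: o_def)
qed (use linear_id in \<open>simp add: id_def\<close>)

lemma operator_tendsto: "(u \<longlongrightarrow> x) F \<Longrightarrow> ((\<lambda>i. T (u i)) \<longlongrightarrow> T x) F"
  using T_op unfolding continuous_operators_def continuous_on_eq_continuous_at[OF open_UNIV]
  by (simp add: isCont_tendsto_compose)

lemma powers_equicontinuous: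
  assumes "open U" "0 \<in> U"
  shows "\<exists>V. open V \<and> 0 \<in> V \<and> (\<forall>n. (T ^^ n) ` V \<subseteq> U)"
proof -
  have "equicontinuous (range (\<lambda>n. T ^^ n))"
    using T_pb by (simp add: power_bounded_def full_SetCompr_eq)
  then show ?thesis
    using assms unfolding equicontinuous_def by simp
qed

lemma cesaro_mean_linear: "linear (cesaro_mean T n)"
  unfolding cesaro_mean_def
  by (intro linearI)
    (simp_all add: linear_add[OF power_linear] linear_cmul[OF power_linear] sum.distrib
      scaleR_add_right scaleR_sum_right[symmetric] mult.commute)

text \<open>Local convexity enters here: a convex neighbourhood that contains \<open>(T ^^ k) x\<close> for all \<open>k\<close> also
  contains the averages.\<close>

lemma cesaro_mean_equicontinuous:
  assumes "open U" "0 \<in> U"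
  shows "\<exists>V. open V \<and> 0 \<in> V \<and> (\<forall>n. cesaro_mean T n ` V \<subseteq> U)"
proof -
  obtain W where W: "open W" "0 \<in> W" "convex W" "W \<subseteq> U"
    using locally_convex[OF assms] by blast
  obtain V where V: "open V" "0 \<in> V" "\<And>n. (T ^^ n) ` V \<subseteq> W"
    using powers_equicontinuous[OF W(1,2)] by blast
  have "cesaro_mean T n x \<in> U" if "x \<in> V" for n x
  proof (cases "n = 0")
    case True
    then show ?thesis using assms by (simp add: cesaro_mean_def)
  next
    case False
    have "(\<Sum>k<n. (1 / real n) *\<^sub>R (T ^^ k) x) \<in> W"
      using W(3) False V(3) that by (intro convex_sum) auto
    then show ?thesis
      using W(4) by (auto simp: cesaro_mean_def scaleR_sum_right)
  qed
  then show ?thesis using V(1,2) by blast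
qed

lemma power_orbit_bounded: "lcs_bounded (range (\<lambda>n. (T ^^ n) x))"
  by (rule lcs_bounded_orbit_if_equicontinuous[OF powers_equicontinuous power_linear])

lemma cesaro_orbit_bounded: "lcs_bounded (range (\<lambda>n. cesaro_mean T n x))"
  by (rule lcs_bounded_orbit_if_equicontinuous[OF cesaro_mean_equicontinuous cesaro_mean_linear])

lemma cesaro_mean_telescope:
  "cesaro_mean T n (x - T x) = (1 / real n) *\<^sub>R x - (1 / real n) *\<^sub>R (T ^^ n) x"
proof -
  have "(\<Sum>k<n. (T ^^ k) (x - T x)) = x - (T ^^ n) x"
  proof (induction n)
    case (Suc n)
    then show ?case
      by (simp add: linear_diff[OF power_linear] funpow_swap1)
  qed simp
  then show ?thesis by (simp add: cesaro_mean_def scaleR_diff_right)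
qed

text \<open>On the range of \<open>id - T\<close> the averages telescope to \<open>(x - T\<^sup>n x) / n\<close>, and the orbit of \<open>x\<close> is bounded.\<close>

lemma cesaro_mean_coboundary_tendsto_0: "(\<lambda>n. cesaro_mean T n (x - T x)) \<longlonglongrightarrow> 0"
proof -
  have "(\<lambda>n. (1 / real n) *\<^sub>R x) \<longlonglongrightarrow> 0 *\<^sub>R x"
    by (intro tendsto_scaleR_lcs tendsto_const lim_1_over_n)
  from tendsto_diff[OF this bounded_over_n_tendsto_0[OF power_orbit_bounded[of x]]]
  show ?thesis by (simp add: cesaro_mean_telescope)
qed

lemma cesaro_mean_power_diff_tendsto_0: "(\<lambda>n. cesaro_mean T n (x - (T ^^ k) x)) \<longlonglongrightarrow> 0"
proof (induction k)
  case 0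
  then show ?case by (simp add: linear_0[OF cesaro_mean_linear])
next
  case (Suc k)
  have "x - (T ^^ Suc k) x = (x - (T ^^ k) x) + ((T ^^ k) x - T ((T ^^ k) x))" by simp
  then show ?case
    using tendsto_add[OF Suc cesaro_mean_coboundary_tendsto_0[of "(T ^^ k) x"]]
    by (simp only: linear_add[OF cesaro_mean_linear]) simp
qed

text \<open>The vector \<open>x - cesaro_mean T m x\<close> is the average of the vectors \<open>x - T\<^sup>k x\<close>, each of which lies in
  the range of \<open>id - T\<close>. For \<open>m = 0\<close> this fails, as \<open>cesaro_mean T 0 x\<close> is \<open>0\<close> by the
  convention on division.\<close>

lemma cesaro_mean_diff_mean_tendsto_0:
  assumes "m > 0"
  shows "(\<lambda>n. cesaro_mean T n (x - cesaro_mean T m x)) \<longlonglongrightarrow> 0"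
proof -
  have "x - cesaro_mean T m x = (1 / real m) *\<^sub>R (\<Sum>k<m. x - (T ^^ k) x)"
    using assms by (simp add: cesaro_mean_def sum_subtractf scaleR_diff_right sum_constant_scaleR)
  then have "cesaro_mean T n (x - cesaro_mean T m x) =
      (1 / real m) *\<^sub>R (\<Sum>k<m. cesaro_mean T n (x - (T ^^ k) x))" for n
    by (simp only: linear_cmul[OF cesaro_mean_linear] linear_sum[OF cesaro_mean_linear])
  moreover have "(\<lambda>n. (1 / real m) *\<^sub>R (\<Sum>k<m. cesaro_mean T n (x - (T ^^ k) x)))
      \<longlonglongrightarrow> (1 / real m) *\<^sub>R (\<Sum>k<m. 0)"
    by (intro tendsto_scaleR_lcs tendsto_const tendsto_sum cesaro_mean_power_diff_tendsto_0)
  ultimately show ?thesis by simp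
qed

lemma cesaro_mean_fixed_point:
  assumes "T y = y" "n > 0"
  shows "cesaro_mean T n y = y"
proof -
  have "(T ^^ k) y = y" for k by (induction k) (auto simp: assms(1))
  then show ?thesis using assms(2) by (simp add: cesaro_mean_def sum_constant_scaleR)
qed

text \<open>The limit \<open>y\<close> along the subnet is a fixed point, since \<open>T\<close> moves the \<open>n\<close>-th average of \<open>x\<close> by
  \<open>(x - T\<^sup>n x) / n\<close>. The full sequence minus \<open>y\<close> is therefore the sequence of averages of \<open>x - y\<close>, which is
  the sum of \<open>x - cesaro_mean T m x\<close>, whose averages tend to \<open>0\<close>, and of \<open>cesaro_mean T m x - y\<close>, which is
  small for a suitable \<open>m\<close> and whose averages are then uniformly small by equicontinuity.\<close>

lemma cesaro_mean_tendsto_cluster_point: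
  assumes H: "H \<le> sequentially" "H \<noteq> bot" and y: "((\<lambda>n. cesaro_mean T n x) \<longlongrightarrow> y) H"
  shows "(\<lambda>n. cesaro_mean T n x) \<longlonglongrightarrow> y"
proof -
  have "((\<lambda>n. cesaro_mean T n (x - T x)) \<longlongrightarrow> 0) H"
    by (rule filterlim_mono[OF cesaro_mean_coboundary_tendsto_0 order_refl H(1)])
  moreover have "cesaro_mean T n (x - T x) = cesaro_mean T n x - T (cesaro_mean T n x)" for n
    by (simp add: linear_diff[OF cesaro_mean_linear])
       (simp add: cesaro_mean_def linear_cmul[OF operator_linear] linear_sum[OF operator_linear]
        funpow_swap1)
  ultimately have "((\<lambda>n. cesaro_mean T n x - T (cesaro_mean T n x)) \<longlongrightarrow> 0) H" by simp
  moreover have "((\<lambda>n. cesaro_mean T n x - T (cesaro_mean T n x)) \<longlongrightarrow> y - T y) H"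
    by (intro tendsto_diff operator_tendsto y)
  ultimately have fixed: "T y = y"
    using tendsto_unique[OF H(2)] by fastforce
  show ?thesis
  proof (rule topological_tendstoI)
    fix U assume "open U" "y \<in> U"
    define U0 where "U0 = (\<lambda>z. z + y) -` U"
    have "open U0" "0 \<in> U0"
      unfolding U0_def using \<open>open U\<close> \<open>y \<in> U\<close>
      by (auto intro!: open_vimage continuous_intros)
    then obtain W where W: "open W" "0 \<in> W" "\<And>x y. x \<in> W \<Longrightarrow> y \<in> W \<Longrightarrow> x + y \<in> U0"
      using open_half_neighbourhood[of U0] by blast
    obtain V where V: "open V" "0 \<in> V" "\<And>n x. x \<in> V \<Longrightarrow> cesaro_mean T n x \<in> W"
      using cesaro_mean_equicontinuous[OF W(1,2)] by blast
    have "((\<lambda>n. cesaro_mean T n x - y) \<longlongrightarrow> y - y) H"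
      by (intro tendsto_diff y tendsto_const)
    then have "\<forall>\<^sub>F m in H. cesaro_mean T m x - y \<in> V"
      using V(1,2) by (auto dest: topological_tendstoD)
    moreover have "\<forall>\<^sub>F m in H. m > 0"
      using eventually_gt_at_top[of 0] H(1) by (metis filter_leD)
    ultimately have "\<forall>\<^sub>F m in H. cesaro_mean T m x - y \<in> V \<and> m > 0"
      by (rule eventually_conj)
    from eventually_happens'[OF H(2) this]
    obtain m where m: "cesaro_mean T m x - y \<in> V" "m > 0"
      by blast
    have "\<forall>\<^sub>F n in sequentially. cesaro_mean T n (x - cesaro_mean T m x) \<in> W"
      using cesaro_mean_diff_mean_tendsto_0[OF m(2)] W(1,2) by (auto dest: topological_tendstoD)
    then show "\<forall>\<^sub>F n in sequentially. cesaro_mean T n x \<in> U"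
      using eventually_gt_at_top[of 0]
    proof eventually_elim
      case (elim n)
      have "cesaro_mean T n x - y = cesaro_mean T n (x - y)"
        using elim by (simp add: linear_diff[OF cesaro_mean_linear] cesaro_mean_fixed_point[OF fixed])
      also have "\<dots> = cesaro_mean T n (x - cesaro_mean T m x) + cesaro_mean T n (cesaro_mean T m x - y)"
        by (simp add: linear_add[OF cesaro_mean_linear, symmetric])
      also have "\<dots> \<in> U0" using elim m(1) V(3) W(3) by blast
      finally show ?case by (simp add: U0_def)
    qed
  qed
qed

context
  fixes P :: "'e \<Rightarrow> 'e"
  assumes P: "\<And>x. (\<lambda>n. cesaro_mean T n x) \<longlonglongrightarrow> P x"
begin

lemma cesaro_limit_clinear: "clinear_map P"
  unfolding clinear_map_def
proof (intro conjI allI)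
  fix x y
  have "(\<lambda>n. cesaro_mean T n (x + y)) \<longlonglongrightarrow> P x + P y"
    using tendsto_add[OF P[of x] P[of y]] by (simp add: linear_add[OF cesaro_mean_linear])
  then show "P (x + y) = P x + P y" using P LIMSEQ_unique by blast
next
  fix c x
  have *: "(T ^^ k) (c *\<^sub>C x) = c *\<^sub>C (T ^^ k) x" for k
    using T_op by (induction k) (auto simp: continuous_operators_def clinear_map_def)
  have sum: "(\<Sum>k\<in>A. c *\<^sub>C f k) = c *\<^sub>C (\<Sum>k\<in>A. f k)" if "finite A" for A :: "nat set" and f :: "nat \<Rightarrow> 'e"
    using that by (induction A) (auto simp: scaleC_add_right, metis add_cancel_right_right scaleC_add_right)
  have "cesaro_mean T n (c *\<^sub>C x) = c *\<^sub>C cesaro_mean T n x" for n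
    unfolding cesaro_mean_def * by (simp add: sum scaleR_scaleC scaleC_scaleC mult.commute)
  moreover have "(\<lambda>n. c *\<^sub>C cesaro_mean T n x) \<longlonglongrightarrow> c *\<^sub>C P x"
    using filterlim_compose[OF tendsto_scaleC_Pair filterlim_Pair[OF tendsto_const P]] by simp
  ultimately show "P (c *\<^sub>C x) = c *\<^sub>C P x" using P[of "c *\<^sub>C x"] LIMSEQ_unique by fastforce
qed

lemma cesaro_limit_linear: "linear P"
  using cesaro_limit_clinear by (intro linearI) (auto simp: clinear_map_def scaleR_scaleC)

text \<open>A pointwise limit inherits equicontinuity: \<open>P x\<close> differs from some average of \<open>x\<close> by as little as
  desired. The neighbourhood is made to work for \<open>- P x\<close> as well, so that both the limit and the deviations
  from it are controlled.\<close>

lemma cesaro_deviation_equicontinuous: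
  assumes U: "open U" "0 \<in> U"
  shows "\<exists>V. open V \<and> 0 \<in> V \<and> (\<forall>x\<in>V. P x \<in> U \<and> (\<forall>n. cesaro_mean T n x - P x \<in> U))"
proof -
  obtain W where W: "open W" "0 \<in> W" "\<And>x y. x \<in> W \<Longrightarrow> y \<in> W \<Longrightarrow> x + y \<in> U"
    using open_half_neighbourhood[OF U] by blast
  have "open (W \<inter> uminus -` W)" "0 \<in> W \<inter> uminus -` W"
    using W(1,2) by (auto intro!: open_Int open_vimage continuous_intros)
  from open_half_neighbourhood[OF this]
  obtain W1 where W1: "open W1" "0 \<in> W1" "\<And>x y. x \<in> W1 \<Longrightarrow> y \<in> W1 \<Longrightarrow> x + y \<in> W \<inter> uminus -` W"
    by blast
  obtain V where V: "open V" "0 \<in> V" "\<And>n x. x \<in> V \<Longrightarrow> cesaro_mean T n x \<in> W1"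
    using cesaro_mean_equicontinuous[OF W1(1,2)] by blast
  have "P x \<in> W \<inter> uminus -` W" if "x \<in> V" for x
  proof -
    have "(\<lambda>n. P x - cesaro_mean T n x) \<longlonglongrightarrow> P x - P x"
      by (intro tendsto_diff tendsto_const P)
    then have "\<forall>\<^sub>F n in sequentially. P x - cesaro_mean T n x \<in> W1"
      using W1(1,2) by (auto dest: topological_tendstoD)
    then obtain n where "P x - cesaro_mean T n x \<in> W1"
      using eventually_happens' sequentially_bot by blast
    from W1(3)[OF this V(3)[OF that, of n]] show ?thesis by simp
  qed
  then have PV: "P x \<in> W" "- P x \<in> W" if "x \<in> V" for x using that by auto
  have "cesaro_mean T n x \<in> W" if "x \<in> V" for n x
    using W1(3)[OF V(3)[OF that] W1(2)] by simp
  then have "P x \<in> U \<and> (\<forall>n. cesaro_mean T n x - P x \<in> U)" if "x \<in> V" for x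
    using W(3)[OF PV(1) W(2)] W(3)[OF _ PV(2)] that by simp
  then show ?thesis using V(1,2) by blast
qed

lemma cesaro_limit_operator: "P \<in> continuous_operators"
proof -
  have "(P \<longlongrightarrow> P x) (nhds x)" for x
  proof (rule topological_tendstoI)
    fix U assume U: "open U" "P x \<in> U"
    have "open ((\<lambda>z. z + P x) -` U)" "0 \<in> (\<lambda>z. z + P x) -` U"
      using U by (auto intro!: open_vimage continuous_intros)
    then obtain V where V: "open V" "0 \<in> V" "\<And>z. z \<in> V \<Longrightarrow> P z + P x \<in> U"
      using cesaro_deviation_equicontinuous[of "(\<lambda>z. z + P x) -` U"] by auto
    have "open ((\<lambda>z. z - x) -` V)" "x \<in> (\<lambda>z. z - x) -` V"
      using V by (auto intro!: open_vimage continuous_intros)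
    moreover have "P z \<in> U" if "z \<in> (\<lambda>z. z - x) -` V" for z
      using V(3)[of "z - x"] that by (simp add: linear_diff[OF cesaro_limit_linear])
    ultimately show "\<forall>\<^sub>F z in nhds x. P z \<in> U"
      unfolding eventually_nhds by blast
  qed
  then have "continuous_on UNIV P"
    unfolding continuous_on_def at_within_def by (blast intro: filterlim_mono order_refl inf_le1)
  with cesaro_limit_clinear show ?thesis by (simp add: continuous_operators_def)
qed

end

text \<open>Yosida's mean ergodic theorem, in spaces in which every bounded set is relatively compact. Pointwise
  convergence is obtained from a cluster point of the bounded sequence of averages. If convergence were not
  uniform on the bounded set \<open>B\<close>, infinitely many indices \<open>n\<close> would have witnesses \<open>z n\<close> in \<open>B\<close>; these
  cluster at some \<open>g\<close>, and by equicontinuity the deviation at \<open>z n\<close> differs little from the one at \<open>g\<close>, which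
  tends to \<open>0\<close>.\<close>

lemma uniformly_mean_ergodic_if_bounded_sets_cluster:
  assumes cluster: "\<And>(B::'e set) F. lcs_bounded B \<Longrightarrow> F \<noteq> bot \<Longrightarrow> \<forall>\<^sub>F x in F. x \<in> B \<Longrightarrow>
    \<exists>g. inf (nhds g) F \<noteq> bot"
  shows "uniformly_mean_ergodic T"
proof -
  have "\<exists>y. (\<lambda>n. cesaro_mean T n x) \<longlonglongrightarrow> y" for x
  proof -
    have "\<exists>y. inf (nhds y) (filtermap (\<lambda>n. cesaro_mean T n x) sequentially) \<noteq> bot"
      by (rule cluster[OF cesaro_orbit_bounded[of x]]) (auto simp: filtermap_bot_iff eventually_filtermap)
    then show ?thesis
      using cesaro_mean_tendsto_cluster_point subnet_of_cluster_point by blast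
  qed
  then obtain P where P: "\<And>x. (\<lambda>n. cesaro_mean T n x) \<longlonglongrightarrow> P x" by metis
  have "P \<in> continuous_operators" using P by (rule cesaro_limit_operator)
  moreover have "converges_uniformly_on_bounded (cesaro_mean T) P"
    unfolding converges_uniformly_on_bounded_def
  proof (intro allI impI, rule ccontr)
    fix B U :: "'e set"
    assume BU: "lcs_bounded B \<and> open U \<and> 0 \<in> U"
      and "\<not> (\<forall>\<^sub>F n in sequentially. \<forall>x\<in>B. cesaro_mean T n x - P x \<in> U)"
    define bad where "bad = {n. \<exists>x\<in>B. cesaro_mean T n x - P x \<notin> U}"
    define F where "F = inf sequentially (principal bad)"
    have "F \<noteq> bot"
    proof
      assume "F = bot"
      then have "\<forall>\<^sub>F n in sequentially. n \<notin> bad"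
        unfolding F_def trivial_limit_def eventually_inf_principal by simp
      then have "\<forall>\<^sub>F n in sequentially. \<forall>x\<in>B. cesaro_mean T n x - P x \<in> U"
        by eventually_elim (auto simp: bad_def)
      then show False using \<open>\<not> _\<close> by blast
    qed
    have "\<forall>n\<in>bad. \<exists>x. x \<in> B \<and> cesaro_mean T n x - P x \<notin> U"
      by (auto simp: bad_def)
    from bchoice[OF this]
    obtain z where z: "\<And>n. n \<in> bad \<Longrightarrow> z n \<in> B \<and> cesaro_mean T n (z n) - P (z n) \<notin> U"
      by blast
    have bad: "\<forall>\<^sub>F n in F. n \<in> bad"
      unfolding F_def by (simp add: eventually_inf_principal)
    have "\<exists>g. inf (nhds g) (filtermap z F) \<noteq> bot"
    proof (rule cluster)
      show "\<forall>\<^sub>F x in filtermap z F. x \<in> B"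
        unfolding eventually_filtermap using bad by eventually_elim (use z in blast)
    qed (use BU \<open>F \<noteq> bot\<close> in \<open>auto simp: filtermap_bot_iff\<close>)
    then obtain g H where H: "H \<le> F" "H \<noteq> bot" "(z \<longlongrightarrow> g) H"
      using subnet_of_cluster_point by blast
    obtain W where W: "open W" "0 \<in> W" "\<And>x y. x \<in> W \<Longrightarrow> y \<in> W \<Longrightarrow> x + y \<in> U"
      using BU open_half_neighbourhood[of U] by blast
    obtain V where V: "open V" "0 \<in> V" "\<And>x n. x \<in> V \<Longrightarrow> cesaro_mean T n x - P x \<in> W"
      using cesaro_deviation_equicontinuous[OF P W(1,2)] by blast
    have "((\<lambda>n. z n - g) \<longlongrightarrow> g - g) H" by (intro tendsto_diff H(3) tendsto_const)
    then have "\<forall>\<^sub>F n in H. z n - g \<in> V" using V(1,2) by (auto dest: topological_tendstoD)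
    moreover have "(\<lambda>n. cesaro_mean T n g - P g) \<longlonglongrightarrow> P g - P g"
      by (intro tendsto_diff P tendsto_const)
    then have "\<forall>\<^sub>F n in sequentially. cesaro_mean T n g - P g \<in> W"
      using W(1,2) by (auto dest: topological_tendstoD)
    then have "\<forall>\<^sub>F n in H. cesaro_mean T n g - P g \<in> W"
      using H(1) unfolding F_def by (metis filter_leD le_inf_iff)
    moreover have "\<forall>\<^sub>F n in H. n \<in> bad" using bad H(1) by (metis filter_leD)
    ultimately have "\<forall>\<^sub>F n in H. False"
    proof eventually_elim
      case (elim n)
      have "cesaro_mean T n (z n) - P (z n) =
          (cesaro_mean T n (z n - g) - P (z n - g)) + (cesaro_mean T n g - P g)"
        by (simp add: linear_diff[OF cesaro_mean_linear] linear_diff[OF cesaro_limit_linear[OF P]])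
      also have "\<dots> \<in> U" using elim V(3) W(3) by blast
      finally show False using elim z by blast
    qed
    then show False using H(2) by (simp add: eventually_False)
  qed
  ultimately show ?thesis unfolding uniformly_mean_ergodic_def by blast
qed

end

section \<open>Compactness of families of functions\<close>

text \<open>Tychonoff's theorem for a product of closed discs. Subsequences would not suffice when the index set
  of the product is the ball of a non-separable space.\<close>

lemma pointwise_bounded_imp_convergent_subnet:
  fixes u :: "'i \<Rightarrow> 'a \<Rightarrow> complex"
  assumes "F \<noteq> bot" "\<forall>\<^sub>F i in F. \<forall>x. cmod (u i x) \<le> M x"
  shows "\<exists>H g. H \<le> F \<and> H \<noteq> bot \<and> (\<forall>x. ((\<lambda>i. u i x) \<longlongrightarrow> g x) H)"
proof -
  let ?K = "PiE UNIV (\<lambda>x. cball 0 (M x)) :: ('a \<Rightarrow> complex) set"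
  have "compactin (product_topology (\<lambda>x. euclidean) UNIV) ?K"
    by (simp add: compactin_PiE)
  then have "compact ?K"
    by (simp only: euclidean_product_topology compactin_euclidean_iff)
  moreover have "\<forall>\<^sub>F f in filtermap u F. f \<in> ?K"
    using assms(2) unfolding eventually_filtermap by eventually_elim auto
  moreover have "filtermap u F \<noteq> bot"
    using assms(1) by (simp add: filtermap_bot_iff)
  ultimately obtain g where "inf (nhds g) (filtermap u F) \<noteq> bot"
    unfolding compact_filter by blast
  then obtain H where H: "H \<le> F" "H \<noteq> bot" "(u \<longlongrightarrow> g) H"
    using subnet_of_cluster_point by blast
  have "((\<lambda>i. u i x) \<longlongrightarrow> g x) H" for x
    using continuous_on_tendsto_compose[OF continuous_on_product_coordinates H(3)] by simp
  with H(1,2) show ?thesis by blast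
qed

text \<open>The easy half of the Ascoli theorem: finitely many points of \<open>K\<close> control all others, and the limit
  satisfies the same modulus of continuity as the functions \<open>u i\<close>.\<close>

lemma equicontinuous_pointwise_imp_uniform_limit:
  fixes u :: "'i \<Rightarrow> 'a::metric_space \<Rightarrow> 'b::metric_space"
  assumes "compact K" "H \<noteq> bot"
    and lim: "\<And>x. x \<in> K \<Longrightarrow> ((\<lambda>i. u i x) \<longlongrightarrow> g x) H"
    and equi: "\<And>x e. x \<in> K \<Longrightarrow> e > 0 \<Longrightarrow>
      \<exists>d>0. \<forall>\<^sub>F i in H. \<forall>y\<in>K. dist y x < d \<longrightarrow> dist (u i y) (u i x) \<le> e"
  shows "uniform_limit K u g H"
  unfolding uniform_limit_iff
proof (intro allI impI)
  fix e :: real assume "e > 0"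
  then have e4: "e / 4 > 0" by simp
  have "\<forall>x\<in>K. \<exists>d>0. \<forall>\<^sub>F i in H. \<forall>y\<in>K. dist y x < d \<longrightarrow> dist (u i y) (u i x) \<le> e / 4"
    using equi[OF _ e4] by (rule ballI)
  from bchoice[OF this] obtain d where d: "\<And>x. x \<in> K \<Longrightarrow> d x > 0"
    "\<And>x. x \<in> K \<Longrightarrow> \<forall>\<^sub>F i in H. \<forall>y\<in>K. dist y x < d x \<longrightarrow> dist (u i y) (u i x) \<le> e / 4"
    by blast
  obtain C where C: "C \<subseteq> K" "finite C" "K \<subseteq> (\<Union>x\<in>C. ball x (d x))"
  proof (rule compactE_image[OF \<open>compact K\<close>, of K "\<lambda>x. ball x (d x)"])
    show "K \<subseteq> (\<Union>x\<in>K. ball x (d x))" using d(1) by force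
  qed auto
  have near: "dist (g y) (g x) \<le> e / 4" if "x \<in> K" "y \<in> K" "dist y x < d x" for x y
  proof (rule tendsto_upperbound[OF tendsto_dist[OF lim[OF that(2)] lim[OF that(1)]] _ \<open>H \<noteq> bot\<close>])
    show "\<forall>\<^sub>F i in H. dist (u i y) (u i x) \<le> e / 4"
      using d(2)[OF that(1)] by eventually_elim (use that in blast)
  qed
  have "\<forall>\<^sub>F i in H. \<forall>x\<in>C. (\<forall>y\<in>K. dist y x < d x \<longrightarrow> dist (u i y) (u i x) \<le> e / 4) \<and>
      dist (u i x) (g x) < e / 4"
    using C(1) by (intro eventually_ball_finite[OF C(2)] ballI eventually_conj d(2)
        tendstoD[OF lim e4]) auto
  then show "\<forall>\<^sub>F i in H. \<forall>y\<in>K. dist (u i y) (g y) < e"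
  proof eventually_elim
    case (elim i)
    show ?case
    proof
      fix y assume "y \<in> K"
      then obtain x where x: "x \<in> C" "dist y x < d x"
        using C(3) by (force simp: dist_commute)
      have "dist (u i y) (g y) \<le> dist (u i y) (u i x) + dist (u i x) (g x) + dist (g y) (g x)"
        by metric
      also have "\<dots> < e / 4 + e / 4 + e / 4 + e / 4"
        using elim x \<open>y \<in> K\<close> near[of x y] C(1) e4 by (smt (verit) subsetD)
      finally show "dist (u i y) (g y) < e" by simp
    qed
  qed
qed

section \<open>Cauchy estimates\<close>

text \<open>Cauchy's inequality on a disc of radius \<open>R / 2\<close> around \<open>0\<close> gives the first bound. For the second,
  Cauchy's inequality with radius \<open>R / 4\<close> around the points of the disc of radius \<open>R / 2\<close> bounds the second
  derivative by \<open>2 M / (R / 4)\<^sup>2\<close>, which is the constant in Taylor's formula.\<close>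

lemma bounded_holomorphic_disc_estimates:
  fixes F :: "complex \<Rightarrow> complex"
  assumes hol: "F holomorphic_on ball 0 R" and R: "R > 0"
    and M: "\<And>z. z \<in> ball 0 R \<Longrightarrow> cmod (F z) \<le> M"
  shows "cmod (deriv F 0) \<le> 2 * M / R"
    and "cmod w < R / 2 \<Longrightarrow> cmod (F w - F 0 - deriv F 0 * w) \<le> 32 * M / R\<^sup>2 * (cmod w)\<^sup>2"
proof -
  have Cauchy: "cmod ((deriv ^^ n) F z) \<le> fact n * M / \<rho> ^ n"
    if "\<rho> > 0" "cmod z + \<rho> < R" for z \<rho> n
  proof -
    have sub: "cball z \<rho> \<subseteq> ball 0 R"
    proof
      fix y assume "y \<in> cball z \<rho>"
      then have "norm (y - z) \<le> \<rho>" by (simp add: dist_norm norm_minus_commute)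
      then show "y \<in> ball 0 R" using that(2) norm_triangle_ineq[of z "y - z"] by simp
    qed
    show ?thesis
    proof (rule Cauchy_inequality[OF _ _ that(1)])
      show "F holomorphic_on ball z \<rho>"
        using sub by (intro holomorphic_on_subset[OF hol]) (auto simp: subset_iff)
      show "continuous_on (cball z \<rho>) F"
        using sub by (intro holomorphic_on_imp_continuous_on holomorphic_on_subset[OF hol])
      show "cmod (F x) \<le> M" if "cmod (z - x) = \<rho>" for x
        using sub that by (intro M) (auto simp: dist_norm)
    qed
  qed
  show "cmod (deriv F 0) \<le> 2 * M / R"
    using Cauchy[of "R / 2" 0 1] R by (simp add: field_simps)
  assume w: "cmod w < R / 2"
  have "cmod ((deriv ^^ 0) F w - (\<Sum>i\<le>1. (deriv ^^ i) F 0 * (w - 0) ^ i / fact i))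
      \<le> (32 * M / R\<^sup>2) * cmod (w - 0) ^ Suc 1 / fact 1"
  proof (rule complex_Taylor[where S = "ball 0 (R / 2)"])
    fix i and z :: complex assume "z \<in> ball 0 (R / 2)"
    then have "z \<in> ball 0 R" using R by simp
    then show "((deriv ^^ i) F has_field_derivative (deriv ^^ Suc i) F z) (at z within ball 0 (R / 2))"
      using holomorphic_derivI[OF holomorphic_higher_deriv[OF hol open_ball] open_ball, of z i]
      by (auto intro: DERIV_subset has_field_derivative_at_within)
  next
    fix z :: complex assume "z \<in> ball 0 (R / 2)"
    then show "cmod ((deriv ^^ Suc 1) F z) \<le> 32 * M / R\<^sup>2"
      using Cauchy[of "R / 4" z 2] R by (simp add: power_divide numeral_2_eq_2 field_simps)
  qed (use w R in auto)
  then show "cmod (F w - F 0 - deriv F 0 * w) \<le> 32 * M / R\<^sup>2 * (cmod w)\<^sup>2"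
    by (simp add: power2_eq_square algebra_simps)
qed

lemma bounded_linear_scaleC_left: "bounded_linear (\<lambda>z. z *\<^sub>C (h::'a::complex_normed_vector))"
  by (rule bounded_linear_intro[where K = "norm h"])
    (simp_all add: scaleC_add_left norm_scaleC scaleR_scaleC scaleC_scaleC scaleC_complex_def)

lemma has_field_derivative_slice:
  fixes f :: "'a::complex_normed_vector \<Rightarrow> complex"
  assumes D: "clinear_map D" "(f has_derivative D) (at (x + z *\<^sub>C h))"
  shows "((\<lambda>z. f (x + z *\<^sub>C h)) has_field_derivative D h) (at z)"
proof -
  have "((\<lambda>z. x + z *\<^sub>C h) has_derivative (\<lambda>k. 0 + k *\<^sub>C h)) (at z)"
    by (intro has_derivative_add has_derivative_const
        bounded_linear.has_derivative[OF bounded_linear_scaleC_left] has_derivative_ident)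
  from has_derivative_compose[OF this D(2)]
  have "((\<lambda>z. f (x + z *\<^sub>C h)) has_derivative (\<lambda>k. D (k *\<^sub>C h))) (at z)" by simp
  moreover have "(\<lambda>k. D (k *\<^sub>C h)) = (*) (D h)"
    using D(1) by (auto simp: clinear_map_def scaleC_complex_def mult.commute)
  ultimately show ?thesis by (simp add: has_field_derivative_def)
qed

text \<open>Restricting \<open>f\<close> to the complex line through \<open>x\<close> in direction \<open>h\<close> gives a holomorphic function on the
  disc of radius \<open>r / norm h\<close>, whose value at \<open>1\<close> is \<open>f (x + h)\<close> and whose derivative at \<open>0\<close> is the Frechet
  derivative in direction \<open>h\<close>. The constants depend on \<open>M\<close> and \<open>r\<close> only, so that they are uniform over
  families with a common bound.\<close>

lemma frechet_holomorphic_taylor_bound: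
  fixes f :: "'a::complex_normed_vector \<Rightarrow> complex"
  assumes hol: "f frechet_holomorphic_on ball x r" and r: "r > 0"
    and M: "\<And>y. y \<in> ball x r \<Longrightarrow> cmod (f y) \<le> M"
  shows "\<exists>D. clinear_map D \<and> (\<forall>h. cmod (D h) \<le> 2 * M / r * norm h) \<and>
    (\<forall>h. norm h < r / 2 \<longrightarrow> cmod (f (x + h) - f x - D h) \<le> 32 * M / r\<^sup>2 * (norm h)\<^sup>2)"
proof -
  have der: "\<exists>D. clinear_map D \<and> (f has_derivative D) (at y)" if "y \<in> ball x r" for y
    using hol that unfolding frechet_holomorphic_on_def
    by (metis at_within_open open_ball)
  then obtain D where D: "clinear_map D" "(f has_derivative D) (at x)"
    using r by (metis centre_in_ball)
  have D0: "D 0 = 0"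
    using D(2) by (metis has_derivative_linear linear_0 bounded_linear.linear has_derivative_bounded_linear)
  have est: "cmod (D h) \<le> 2 * M / r * norm h \<and>
      (norm h < r / 2 \<longrightarrow> cmod (f (x + h) - f x - D h) \<le> 32 * M / r\<^sup>2 * (norm h)\<^sup>2)" for h
  proof (cases "h = 0")
    case True
    then show ?thesis using D0 by simp
  next
    case False
    define R where "R = r / norm h"
    define F where "F z = f (x + z *\<^sub>C h)" for z :: complex
    have R: "R > 0" using r False by (simp add: R_def)
    have in_ball: "x + z *\<^sub>C h \<in> ball x r" if "z \<in> ball 0 R" for z :: complex
      using that False by (simp add: R_def dist_norm norm_scaleC field_simps)
    have hol: "F holomorphic_on ball 0 R"
      unfolding F_def
    proof (rule holomorphic_onI)
      fix z :: complex assume "z \<in> ball 0 R"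
      then obtain E where "clinear_map E" "(f has_derivative E) (at (x + z *\<^sub>C h))"
        using der in_ball by blast
      then show "(\<lambda>z. f (x + z *\<^sub>C h)) field_differentiable at z within ball 0 R"
        using has_field_derivative_slice has_field_derivative_at_within
        unfolding field_differentiable_def by blast
    qed
    have bound: "cmod (F z) \<le> M" if "z \<in> ball 0 R" for z :: complex
      using M in_ball[OF that] by (simp add: F_def)
    have zero: "0 *\<^sub>C h = 0" by (metis norm_eq_zero norm_scaleC norm_zero mult_zero_left)
    have "(F has_field_derivative D h) (at 0)"
      unfolding F_def by (rule has_field_derivative_slice) (use D zero in auto)
    then have "deriv F 0 = D h" by (rule DERIV_imp_deriv)
    moreover have "F 0 = f x" "F 1 = f (x + h)" by (simp_all add: F_def zero scaleC_one)
    ultimately show ?thesis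
      using bounded_holomorphic_disc_estimates(1)[OF hol R bound]
        bounded_holomorphic_disc_estimates(2)[OF hol R bound, of 1] False r
      by (auto simp: R_def power_divide field_simps)
  qed
  then show ?thesis using D(1) by blast
qed

lemma has_derivative_if_quadratic_remainder:
  fixes f :: "'a::real_normed_vector \<Rightarrow> 'b::real_normed_vector"
  assumes D: "linear D" "\<And>h. norm (D h) \<le> c * norm h" and "r > 0"
    and remainder: "\<And>h. norm h < r \<Longrightarrow> norm (f (x + h) - f x - D h) \<le> C * (norm h)\<^sup>2"
  shows "(f has_derivative D) (at x within S)"
proof (rule has_derivativeI_sandwich[OF \<open>r > 0\<close>])
  show "bounded_linear D"
    using D by (intro bounded_linear_intro[where K = c])
      (auto simp: linear_add linear_cmul mult.commute)
  show "norm (f y - f x - D (y - x)) / norm (y - x) \<le> C * norm (y - x)"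
    if "y \<noteq> x" "dist y x < r" for y
    using remainder[of "y - x"] that by (simp add: dist_norm field_simps power2_eq_square)
  have "((\<lambda>y. C * norm (y - x)) \<longlongrightarrow> C * norm (x - x)) (at x within S)"
    by (intro tendsto_intros)
  then show "((\<lambda>y. C * norm (y - x)) \<longlongrightarrow> 0) (at x within S)" by simp
qed

section \<open>Montel's theorem on the ball of a normed space\<close>

text \<open>The neighbourhood of \<open>0\<close> given by \<open>K\<close> and the radius \<open>1\<close> absorbs \<open>B\<close>.\<close>

lemma lcs_bounded_imp_bounded_on_compact:
  fixes B :: "'a::complex_normed_vector holo_ball set"
  assumes "lcs_bounded B" "compact K" "K \<subseteq> ball 0 1"
  shows "\<exists>M. \<forall>f\<in>B. \<forall>x\<in>K. cmod (holo_apply f x) \<le> M"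
proof -
  have "open (compact_nbhd 0 K 1 :: 'a holo_ball set)" "(0::'a holo_ball) \<in> compact_nbhd 0 K 1"
    using assms by (auto intro: open_compact_nbhd mem_compact_nbhd)
  then obtain s where s: "s > 0" "\<And>t. t > s \<Longrightarrow> B \<subseteq> (\<lambda>f. t *\<^sub>R f) ` compact_nbhd 0 K 1"
    using assms(1) unfolding lcs_bounded_def by blast
  have "cmod (holo_apply f x) \<le> s + 1" if "f \<in> B" "x \<in> K" for f x
  proof -
    have "f \<in> (\<lambda>f. (s + 1) *\<^sub>R f) ` compact_nbhd 0 K 1"
      by (rule subsetD[OF s(2) that(1)]) simp
    then obtain g where "g \<in> compact_nbhd 0 K 1" "f = (s + 1) *\<^sub>R g"
      by blast
    then show ?thesis
      using that(2) s(1) by (auto simp: compact_nbhd_def norm_mult intro!: mult_left_le less_imp_le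
          simp del: of_real_add)
  qed
  then show ?thesis by blast
qed

text \<open>Compact sets are nowhere dense if the space has infinite dimension, yet they detect local
  unboundedness: a sequence of points that converges to \<open>x\<close> and along which members of \<open>B\<close> are unbounded
  forms, together with \<open>x\<close>, a compact set.\<close>

lemma lcs_bounded_imp_locally_bounded:
  fixes B :: "'a::complex_normed_vector holo_ball set"
  assumes B: "lcs_bounded B" and x: "x \<in> ball 0 1"
  shows "\<exists>r>0. \<exists>M. ball x r \<subseteq> ball 0 1 \<and> (\<forall>f\<in>B. \<forall>y\<in>ball x r. cmod (holo_apply f y) \<le> M)"
proof (rule ccontr)
  assume contra: "\<not> ?thesis"
  obtain r where r: "r > 0" "ball x r \<subseteq> ball 0 1"
    using x open_ball open_contains_ball by blast
  define \<delta> where "\<delta> n = r / real (Suc n)" for n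
  have \<delta>: "\<delta> n > 0" "\<delta> n \<le> r" for n
    using r(1) by (auto simp: \<delta>_def field_simps)
  have "\<exists>f y. f \<in> B \<and> y \<in> ball x (\<delta> n) \<and> cmod (holo_apply f y) > real n" for n
  proof -
    have "ball x (\<delta> n) \<subseteq> ball 0 1"
      using r(2) \<delta>(2)[of n] by (meson order_trans subset_ball)
    then have "\<not> (\<forall>f\<in>B. \<forall>y\<in>ball x (\<delta> n). cmod (holo_apply f y) \<le> real n)"
      using contra \<delta>(1)[of n] by blast
    then show ?thesis unfolding not_le[symmetric] by blast
  qed
  then obtain f y where fy: "\<And>n. f n \<in> B" "\<And>n. y n \<in> ball x (\<delta> n)"
    "\<And>n. cmod (holo_apply (f n) (y n)) > real n"
    by metis
  have "\<delta> \<longlonglongrightarrow> 0"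
    unfolding \<delta>_def using LIMSEQ_Suc[OF lim_const_over_n[of r]] by simp
  then have "(\<lambda>n. dist (y n) x) \<longlonglongrightarrow> 0"
    by (rule Lim_null_comparison[rotated])
      (use fy(2) in \<open>auto simp: dist_commute less_imp_le\<close>)
  then have "y \<longlonglongrightarrow> x" by (rule tendsto_dist_iff[THEN iffD2])
  then have "compact (insert x (range y))"
    using compactin_sequence_with_limit[of euclidean y x "range y"] by simp
  moreover have "insert x (range y) \<subseteq> ball 0 1"
    using x fy(2) r(2) \<delta>(2) by (auto simp: subset_iff) (metis less_le_trans mem_ball subset_iff)
  ultimately have "\<exists>M. \<forall>f\<in>B. \<forall>z\<in>insert x (range y). cmod (holo_apply f z) \<le> M"
    by (rule lcs_bounded_imp_bounded_on_compact[OF B])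
  then obtain M where M: "\<And>f z. f \<in> B \<Longrightarrow> z \<in> insert x (range y) \<Longrightarrow> cmod (holo_apply f z) \<le> M"
    by blast
  obtain n where "M < real n" using reals_Archimedean2 by blast
  with fy(3)[of n] M[OF fy(1)[of n], of "y n"] show False by simp
qed

text \<open>The point is that \<open>c\<close>, \<open>C\<close> and \<open>r\<close> serve all members of \<open>B\<close> at once: they come from a common bound on
  a ball around \<open>x\<close>.\<close>

lemma lcs_bounded_imp_equi_differentiable:
  fixes B :: "'a::complex_normed_vector holo_ball set"
  assumes B: "lcs_bounded B" and x: "x \<in> ball 0 1"
  shows "\<exists>D c C r. r > 0 \<and> (\<forall>f\<in>B. clinear_map (D f) \<and>
    (\<forall>h. cmod (D f h) \<le> c * norm h) \<and>
    (\<forall>h. norm h < r \<longrightarrow>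
      cmod (holo_apply f (x + h) - holo_apply f x - D f h) \<le> C * (norm h)\<^sup>2))"
proof -
  obtain r M where r: "r > 0" "ball x r \<subseteq> ball 0 1"
    and M: "\<And>f y. f \<in> B \<Longrightarrow> y \<in> ball x r \<Longrightarrow> cmod (holo_apply f y) \<le> M"
    using lcs_bounded_imp_locally_bounded[OF B x] by blast
  have "\<forall>f\<in>B. \<exists>D. clinear_map D \<and> (\<forall>h. cmod (D h) \<le> 2 * M / r * norm h) \<and>
    (\<forall>h. norm h < r / 2 \<longrightarrow>
      cmod (holo_apply f (x + h) - holo_apply f x - D h) \<le> 32 * M / r\<^sup>2 * (norm h)\<^sup>2)"
  proof (intro ballI frechet_holomorphic_taylor_bound r(1))
    fix f assume "f \<in> B"
    show "holo_apply f frechet_holomorphic_on ball x r"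
      using holo_apply_holomorphic[of f] r(2) has_derivative_subset
      unfolding frechet_holomorphic_on_def by blast
  qed (use M in blast)
  from bchoice[OF this] obtain D where "\<forall>f\<in>B. clinear_map (D f) \<and>
      (\<forall>h. cmod (D f h) \<le> 2 * M / r * norm h) \<and>
      (\<forall>h. norm h < r / 2 \<longrightarrow>
        cmod (holo_apply f (x + h) - holo_apply f x - D f h) \<le> 32 * M / r\<^sup>2 * (norm h)\<^sup>2)"
    by blast
  moreover have "r / 2 > 0" using r(1) by simp
  ultimately show ?thesis by blast
qed

text \<open>At distance \<open>t\<close> from \<open>x\<close> the members of \<open>B\<close> vary by at most \<open>c t + C t\<^sup>2\<close>.\<close>

lemma lcs_bounded_imp_equicontinuous_at:
  fixes B :: "'a::complex_normed_vector holo_ball set"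
  assumes B: "lcs_bounded B" and x: "x \<in> ball 0 1" and "e > 0"
  shows "\<exists>d>0. \<forall>f\<in>B. \<forall>y. dist y x < d \<longrightarrow> cmod (holo_apply f y - holo_apply f x) \<le> e"
proof -
  obtain D c C r where r: "r > 0"
    and c: "\<And>f h. f \<in> B \<Longrightarrow> cmod (D f h) \<le> c * norm h"
    and C: "\<And>f h. f \<in> B \<Longrightarrow> norm h < r \<Longrightarrow>
      cmod (holo_apply f (x + h) - holo_apply f x - D f h) \<le> C * (norm h)\<^sup>2"
    using lcs_bounded_imp_equi_differentiable[OF B x] by blast
  have "((\<lambda>t::real. c * t + C * t\<^sup>2) \<longlongrightarrow> c * 0 + C * 0\<^sup>2) (nhds 0)"
    by (intro tendsto_intros filterlim_ident)
  then have "\<forall>\<^sub>F t in nhds 0. c * t + C * t\<^sup>2 < e"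
    using \<open>e > 0\<close> by (intro order_tendstoD(2)) auto
  then obtain s where s: "s > 0" "\<And>t. \<bar>t\<bar> < s \<Longrightarrow> c * t + C * t\<^sup>2 < e"
    unfolding eventually_nhds_metric dist_real_def by auto
  have "cmod (holo_apply f y - holo_apply f x) \<le> e" if "f \<in> B" "dist y x < min r s" for f y
  proof -
    define h where "h = y - x"
    have h: "norm h < r" "norm h < s" "y = x + h" using that(2) by (auto simp: h_def dist_norm)
    have "cmod (holo_apply f y - holo_apply f x) \<le>
        cmod (holo_apply f (x + h) - holo_apply f x - D f h) + cmod (D f h)"
      unfolding h(3) using norm_triangle_ineq[of "holo_apply f (x + h) - holo_apply f x - D f h" "D f h"]
      by simp
    also have "\<dots> \<le> C * (norm h)\<^sup>2 + c * norm h"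
      using c[OF that(1)] C[OF that(1) h(1)] by (intro add_mono) auto
    also have "\<dots> \<le> e" using s(2)[of "norm h"] h(2) by simp
    finally show ?thesis .
  qed
  then show ?thesis using r s(1) by (intro exI[of _ "min r s"]) auto
qed

text \<open>The candidate for the derivative of \<open>g\<close> at \<open>x\<close> is a pointwise limit, along a finer filter, of the
  derivatives of the members of \<open>B\<close>; it exists by the uniform bound on these. Each instance of
  complex linearity, of boundedness and of the quadratic bound on the Taylor remainder is a closed condition on
  finitely many values, hence passes to the limit.\<close>

lemma pointwise_limit_frechet_holomorphic:
  fixes B :: "'a::complex_normed_vector holo_ball set"
  assumes B: "lcs_bounded B" and H: "H \<noteq> bot" "\<forall>\<^sub>F f in H. f \<in> B"
    and g: "\<And>x. ((\<lambda>f. holo_apply f x) \<longlongrightarrow> g x) H"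
  shows "g frechet_holomorphic_on ball 0 1"
  unfolding frechet_holomorphic_on_def
proof
  fix x :: 'a assume x: "x \<in> ball 0 1"
  obtain D c C r where r: "r > 0"
    and lin: "\<And>f. f \<in> B \<Longrightarrow> clinear_map (D f)"
    and c: "\<And>f h. f \<in> B \<Longrightarrow> cmod (D f h) \<le> c * norm h"
    and C: "\<And>f h. f \<in> B \<Longrightarrow> norm h < r \<Longrightarrow>
      cmod (holo_apply f (x + h) - holo_apply f x - D f h) \<le> C * (norm h)\<^sup>2"
    using lcs_bounded_imp_equi_differentiable[OF B x] by blast
  have "\<forall>\<^sub>F f in H. \<forall>h. cmod (D f h) \<le> c * norm h"
    using H(2) by eventually_elim (use c in blast)
  from pointwise_bounded_imp_convergent_subnet[OF H(1) this]
  obtain H' E where H': "H' \<le> H" "H' \<noteq> bot" and E: "\<And>h. ((\<lambda>f. D f h) \<longlongrightarrow> E h) H'"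
    by blast
  have inB: "\<forall>\<^sub>F f in H'. f \<in> B" using H(2) H'(1) by (rule filter_leD[rotated])
  have g': "((\<lambda>f. holo_apply f x) \<longlongrightarrow> g x) H'" for x
    using g H'(1) by (rule tendsto_mono[rotated])
  have "clinear_map E"
    unfolding clinear_map_def
  proof (intro conjI allI)
    fix h k
    show "E (h + k) = E h + E k"
    proof (rule tendsto_unique[OF H'(2) E])
      have "\<forall>\<^sub>F f in H'. D f h + D f k = D f (h + k)"
        using inB by eventually_elim (use lin in \<open>simp add: clinear_map_def\<close>)
      then show "((\<lambda>f. D f (h + k)) \<longlongrightarrow> E h + E k) H'"
        by (rule Lim_transform_eventually[OF tendsto_add[OF E E]])
    qed
  next
    fix a h
    show "E (a *\<^sub>C h) = a *\<^sub>C E h"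
      unfolding scaleC_complex_def
    proof (rule tendsto_unique[OF H'(2) E])
      have "\<forall>\<^sub>F f in H'. a * D f h = D f (a *\<^sub>C h)"
        using inB by eventually_elim (use lin in \<open>simp add: clinear_map_def scaleC_complex_def\<close>)
      then show "((\<lambda>f. D f (a *\<^sub>C h)) \<longlongrightarrow> a * E h) H'"
        by (rule Lim_transform_eventually[OF tendsto_mult_left[OF E]])
    qed
  qed
  moreover have "(g has_derivative E) (at x within ball 0 1)"
  proof (rule has_derivative_if_quadratic_remainder[OF _ _ r])
    show "linear E"
      using \<open>clinear_map E\<close> by (intro linearI) (auto simp: clinear_map_def scaleR_scaleC)
    show "cmod (E h) \<le> c * norm h" for h
      by (rule tendsto_upperbound[OF tendsto_norm[OF E] _ H'(2)])
        (use inB in \<open>eventually_elim, use c in blast\<close>)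
    show "cmod (g (x + h) - g x - E h) \<le> C * (norm h)\<^sup>2" if "norm h < r" for h
      by (rule tendsto_upperbound[OF tendsto_norm[OF tendsto_diff[OF tendsto_diff[OF g' g'] E]] _ H'(2)])
        (use inB in \<open>eventually_elim, use C that in blast\<close>)
  qed
  ultimately show "\<exists>D. clinear_map D \<and> (g has_derivative D) (at x within ball 0 1)" by blast
qed

text \<open>Every bounded set of holomorphic functions is relatively compact: the members that a filter
  concentrates on converge pointwise along a finer filter by Tychonoff's theorem, the limit is again
  holomorphic, and equicontinuity makes the convergence uniform on compact sets.\<close>

theorem holo_ball_Montel:
  fixes B :: "'a::complex_normed_vector holo_ball set"
  assumes B: "lcs_bounded B" and F: "F \<noteq> bot" "\<forall>\<^sub>F f in F. f \<in> B"
  shows "\<exists>g. inf (nhds g) F \<noteq> bot"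
proof -
  have "\<exists>M. \<forall>f\<in>B. cmod (holo_apply f x) \<le> M" for x
  proof (cases "x \<in> ball 0 1")
    case True
    then show ?thesis using lcs_bounded_imp_bounded_on_compact[OF B, of "{x}"] by auto
  qed (auto simp: holo_apply_outside)
  then obtain M where M: "\<And>f x. f \<in> B \<Longrightarrow> cmod (holo_apply f x) \<le> M x" by metis
  have "\<forall>\<^sub>F f in F. \<forall>x. cmod (holo_apply f x) \<le> M x"
    using F(2) by eventually_elim (use M in blast)
  from pointwise_bounded_imp_convergent_subnet[OF F(1) this]
  obtain H g where H: "H \<le> F" "H \<noteq> bot" and g: "\<And>x. ((\<lambda>f. holo_apply f x) \<longlongrightarrow> g x) H"
    by blast
  have inB: "\<forall>\<^sub>F f in H. f \<in> B" using F(2) H(1) by (rule filter_leD[rotated])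
  have hol: "g frechet_holomorphic_on ball 0 1"
    using B H(2) inB g by (rule pointwise_limit_frechet_holomorphic)
  have "g x = 0" if "x \<notin> ball 0 1" for x
  proof (rule tendsto_unique[OF H(2) g])
    show "((\<lambda>f. holo_apply f x) \<longlongrightarrow> 0) H" by (simp add: holo_apply_outside[OF that])
  qed
  with hol have G: "holo_apply (Abs_holo_ball g) = g"
    by (subst Abs_holo_ball_inverse) auto
  have "((\<lambda>f. f) \<longlongrightarrow> Abs_holo_ball g) H"
    unfolding tendsto_holo_ball_iff G
  proof (intro allI impI)
    fix K :: "'a set" assume K: "compact K \<and> K \<subseteq> ball 0 1"
    show "uniform_limit K holo_apply g H"
    proof (rule equicontinuous_pointwise_imp_uniform_limit[OF _ H(2) g])
      fix x and e :: real assume "x \<in> K" "e > 0"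
      then obtain d where "d > 0"
        and d: "\<And>f y. f \<in> B \<Longrightarrow> dist y x < d \<Longrightarrow> cmod (holo_apply f y - holo_apply f x) \<le> e"
        using lcs_bounded_imp_equicontinuous_at[OF B, of x e] K by blast
      have "\<forall>\<^sub>F f in H. \<forall>y\<in>K. dist y x < d \<longrightarrow> dist (holo_apply f y) (holo_apply f x) \<le> e"
        using inB by eventually_elim (simp add: d dist_norm[where 'a=complex])
      with \<open>d > 0\<close> show "\<exists>d>0. \<forall>\<^sub>F f in H. \<forall>y\<in>K. dist y x < d \<longrightarrow>
          dist (holo_apply f y) (holo_apply f x) \<le> e" by blast
    qed (use K in blast)
  qed
  then have "H \<le> nhds (Abs_holo_ball g)" by (simp add: filterlim_def filtermap_ident)
  then have "H \<le> inf (nhds (Abs_holo_ball g)) F" using H(1) by simp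
  then show ?thesis using H(2) by (metis bot.extremum_uniqueI)
qed

section \<open>Power bounded composition operators\<close>

theorem proposition4p4:
  fixes \<phi> :: "'a::complex_banach \<Rightarrow> 'a"
  assumes "\<phi> ` ball 0 1 \<subseteq> ball 0 1"
    and "\<phi> frechet_holomorphic_on ball 0 1"
    and "power_bounded (composition_operator \<phi>)"
  shows "uniformly_mean_ergodic (composition_operator \<phi>)"
  using composition_operator_continuous[OF assms(2,1)] assms(3) holo_ball_Montel
  by (rule uniformly_mean_ergodic_if_bounded_sets_cluster)

end
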